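(* Let $\mathcal{D}$ be a connected graded Hopf algebra and let $f\colon\mathcal{E}\to\mathcal{D}$ be a connection on $\mathcal{D}$. Then $\mathcal{E}$ is also a Hopf module and a comodule algebra over $\mathcal{D}$. It is also a one-sided Hopf algebra, with one-sided unit $1_{\mathcal{E}}:=f^{-1}(1_{\mathcal{D}})$ (the element of $\mathcal{E}_0$ mapped by $f$ to $1_{\mathcal{D}}$) and a one-sided antipode.
   Context: Work over a field $\mathbb{K}$ of characteristic zero. A graded coalgebra is a vector space $\bigoplus_{n\ge0}\mathcal{E}_n$ with a degree-preserving coassociative coproduct and a counit vanishing in positive degrees; it is connected if its degree-$0$ part is $\mathbb{K}$. Let $\mathcal{D}$ be a connected graded Hopf algebra with product $m_{\mathcal D}$, coproduct $\Delta_{\mathcal D}$ and unit $1_{\mathcal D}$. A map $f\colon\mathcal{E}\to\mathcal{D}$ of graded coalgebras is a connection on $\mathcal{D}$ if $\mathcal{E}$ is connected, $\mathcal{E}$ is a $\mathcal{D}$-module coalgebra and $f$ is a map of $\mathcal{D}$-module coalgebras. That is, $\mathcal{E}$ is an associative, unital, graded (left or right) $\mathcal{D}$-module whose action $\star$ commutes with coproducts, e.g. for right modules $\Delta_{\mathcal E}(e\star d)=\Delta_{\mathcal E}(e)\star\Delta_{\mathcal D}(d)$ (componentwise action), and $f$ satisfies $(f\otimes f)\Delta_{\mathcal E}(e)=\Delta_{\mathcal D}f(e)$ and $f(e\star d)=m_{\mathcal D}(f(e)\otimes d)$ (for left modules, $\Delta_{\mathcal E}(d\star e)=\Delta_{\mathcal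 D}(d)\star\Delta_{\mathcal E}(e)$ and $f(d\star e)=m_{\mathcal D}(d\otimes f(e))$). The structures on $\mathcal{E}$ are: the product $e\cdot e':=e\star f(e')$ if $\mathcal{E}$ is a right module, and $e\cdot e':=f(e)\star e'$ if it is a left module; and the coaction $\rho:=(1\otimes f)\Delta_{\mathcal E}\colon\mathcal{E}\to\mathcal{E}\otimes\mathcal{D}$. Hopf module: a $\mathcal{D}$-module that is also a $\mathcal{D}$-comodule via $\rho$, with $\rho(e\star d)=\rho(e)\star\Delta_{\mathcal D}(d)$ (right case) or $\rho(d\star e)=\Delta_{\mathcal D}(d)\star\rho(e)$ (left case), where $\mathcal{D}\otimes \mathcal{D}$ acts on $\mathcal{E}\otimes\mathcal{D}$ by $\star$ on the first factor and by multiplication on the second. Comodule algebra: $\rho$ is a coaction and is multiplicative, $\rho(e\cdot e')=\rho(e)\rho(e')$, with $\rho(1_{\mathcal E})=1_{\mathcal E}\otimes 1_{\mathcal D}$. One-sided Hopf algebra: a coalgebra with an associative product such that the coproduct and counit are multiplicative, having either a right unit $1$ ($e\cdot1=e$ for all $e$) and a left antipode $S$ ($\sum_{(e)}S(e')\cdot e''=\varepsilon(e)1$ for all $e$), or a left unit ($1\cdot e=e$) and a right antipode ($\sum_{(e)}e'\cdot S(e'')=\varepsilon(e)1$). *)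

theory Defs
  imports Complex_Main "HOL-Library.Poly_Mapping"
begin

section \<open>Formal sums and tensor products\<close>

text \<open>
  The type \<open>'x \<Rightarrow>\<^sub>0 'k\<close> of finitely supported functions is the free vector space on \<open>'x\<close>.
  The tensor product of two vector spaces is the quotient of the free vector space on pairs by the
  subspace spanned by the bilinearity relations. Since the scalar multiplications are locale
  parameters, no type can depend on them; elements of a tensor product are therefore given by
  representing formal sums, and equality in the tensor product is \<open>tensor_eq\<close>. A map into a tensor
  product is a choice of one representative for each argument, and its linearity is required up to
  \<open>tensor_eq\<close>.
\<close>

definition fscale :: "'k::field \<Rightarrow> ('x \<Rightarrow>\<^sub>0 'k) \<Rightarrow> ('x \<Rightarrow>\<^sub>0 'k)" where
  "fscale c u = Poly_Mapping.map ((*) c) u"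

lemma lookup_fscale: "Poly_Mapping.lookup (fscale c u) x = c * Poly_Mapping.lookup u x"
  by (simp add: fscale_def Poly_Mapping.map.rep_eq when_def)

lemma vector_space_fscale: "vector_space (fscale :: 'k::field \<Rightarrow> ('x \<Rightarrow>\<^sub>0 'k) \<Rightarrow> _)"
  by unfold_locales
    (auto intro!: poly_mapping_eqI simp: lookup_fscale lookup_add algebra_simps)

text \<open>The linear extension of a map \<open>B\<close> on the basis to the free vector space, with values in the
  vector space with scalar multiplication \<open>s\<close>.\<close>

definition lin_ext :: "('k::field \<Rightarrow> 'v::ab_group_add \<Rightarrow> 'v) \<Rightarrow> ('x \<Rightarrow> 'v) \<Rightarrow> ('x \<Rightarrow>\<^sub>0 'k) \<Rightarrow> 'v" where
  "lin_ext s B u = (\<Sum>x\<in>Poly_Mapping.keys u. s (Poly_Mapping.lookup u x) (B x))"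

definition gen :: "'x \<Rightarrow> ('x \<Rightarrow>\<^sub>0 'k::field)" where
  "gen x = Poly_Mapping.single x 1"

definition tensor_relators ::
  "('k::field \<Rightarrow> 'a::ab_group_add \<Rightarrow> 'a) \<Rightarrow> ('k \<Rightarrow> 'b::ab_group_add \<Rightarrow> 'b) \<Rightarrow> ('a \<times> 'b \<Rightarrow>\<^sub>0 'k) set" where
  "tensor_relators sA sB =
     {gen (a + a', b) - gen (a, b) - gen (a', b) | a a' b. True} \<union>
     {gen (a, b + b') - gen (a, b) - gen (a, b') | a b b'. True} \<union>
     {gen (sA c a, b) - fscale c (gen (a, b)) | c a b. True} \<union>
     {gen (a, sB c b) - fscale c (gen (a, b)) | c a b. True}"

definition tensor_eq ::
  "('k::field \<Rightarrow> 'a::ab_group_add \<Rightarrow> 'a) \<Rightarrow> ('k \<Rightarrow> 'b::ab_group_add \<Rightarrow> 'b)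
    \<Rightarrow> ('a \<times> 'b \<Rightarrow>\<^sub>0 'k) \<Rightarrow> ('a \<times> 'b \<Rightarrow>\<^sub>0 'k) \<Rightarrow> bool" where
  "tensor_eq sA sB u v \<longleftrightarrow> u - v \<in> module.span fscale (tensor_relators sA sB)"

definition tensor3_relators ::
  "('k::field \<Rightarrow> 'a::ab_group_add \<Rightarrow> 'a) \<Rightarrow> ('k \<Rightarrow> 'b::ab_group_add \<Rightarrow> 'b)
    \<Rightarrow> ('k \<Rightarrow> 'c::ab_group_add \<Rightarrow> 'c) \<Rightarrow> ('a \<times> 'b \<times> 'c \<Rightarrow>\<^sub>0 'k) set" where
  "tensor3_relators sA sB sC =
     {gen (a + a', b, c) - gen (a, b, c) - gen (a', b, c) | a a' b c. True} \<union>
     {gen (a, b + b', c) - gen (a, b, c) - gen (a, b', c) | a b b' c. True} \<union>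
     {gen (a, b, c + c') - gen (a, b, c) - gen (a, b, c') | a b c c'. True} \<union>
     {gen (sA k a, b, c) - fscale k (gen (a, b, c)) | k a b c. True} \<union>
     {gen (a, sB k b, c) - fscale k (gen (a, b, c)) | k a b c. True} \<union>
     {gen (a, b, sC k c) - fscale k (gen (a, b, c)) | k a b c. True}"

definition tensor3_eq ::
  "('k::field \<Rightarrow> 'a::ab_group_add \<Rightarrow> 'a) \<Rightarrow> ('k \<Rightarrow> 'b::ab_group_add \<Rightarrow> 'b)
    \<Rightarrow> ('k \<Rightarrow> 'c::ab_group_add \<Rightarrow> 'c)
    \<Rightarrow> ('a \<times> 'b \<times> 'c \<Rightarrow>\<^sub>0 'k) \<Rightarrow> ('a \<times> 'b \<times> 'c \<Rightarrow>\<^sub>0 'k) \<Rightarrow> bool" where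
  "tensor3_eq sA sB sC u v \<longleftrightarrow> u - v \<in> module.span fscale (tensor3_relators sA sB sC)"

text \<open>Applied to linear (respectively bilinear) maps, the following operations on formal sums respect
  the bilinearity relations and so represent the operations on tensor products: \<open>g \<otimes> h\<close>,
  \<open>\<phi> \<otimes> id\<close> and \<open>id \<otimes> \<phi>\<close> for \<open>\<phi>\<close> with values in a tensor product, and the
  componentwise combination \<open>(a \<otimes> b, c \<otimes> d) \<mapsto> m a c \<otimes> m' b d\<close>.\<close>

definition tmap :: "('a \<Rightarrow> 'p) \<Rightarrow> ('b \<Rightarrow> 'q) \<Rightarrow> ('a \<times> 'b \<Rightarrow>\<^sub>0 'k::field) \<Rightarrow> ('p \<times> 'q \<Rightarrow>\<^sub>0 'k)" where
  "tmap g h = lin_ext fscale (\<lambda>(a, b). gen (g a, h b))"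

definition expand_left ::
  "('a \<Rightarrow> ('p \<times> 'q \<Rightarrow>\<^sub>0 'k::field)) \<Rightarrow> ('a \<times> 'b \<Rightarrow>\<^sub>0 'k) \<Rightarrow> ('p \<times> 'q \<times> 'b \<Rightarrow>\<^sub>0 'k)" where
  "expand_left \<phi> = lin_ext fscale (\<lambda>(a, b). lin_ext fscale (\<lambda>(p, q). gen (p, q, b)) (\<phi> a))"

definition expand_right ::
  "('b \<Rightarrow> ('p \<times> 'q \<Rightarrow>\<^sub>0 'k::field)) \<Rightarrow> ('a \<times> 'b \<Rightarrow>\<^sub>0 'k) \<Rightarrow> ('a \<times> 'p \<times> 'q \<Rightarrow>\<^sub>0 'k)" where
  "expand_right \<phi> = lin_ext fscale (\<lambda>(a, b). lin_ext fscale (\<lambda>(p, q). gen (a, p, q)) (\<phi> b))"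

definition tprod :: "('a \<Rightarrow> 'c \<Rightarrow> 'p) \<Rightarrow> ('b \<Rightarrow> 'd \<Rightarrow> 'q)
    \<Rightarrow> ('a \<times> 'b \<Rightarrow>\<^sub>0 'k::field) \<Rightarrow> ('c \<times> 'd \<Rightarrow>\<^sub>0 'k) \<Rightarrow> ('p \<times> 'q \<Rightarrow>\<^sub>0 'k)" where
  "tprod m m' u v =
     lin_ext fscale (\<lambda>(a, b). lin_ext fscale (\<lambda>(c, d). gen (m a c, m' b d)) v) u"

definition bilinear_map ::
  "('k::field \<Rightarrow> 'a::ab_group_add \<Rightarrow> 'a) \<Rightarrow> ('k \<Rightarrow> 'b::ab_group_add \<Rightarrow> 'b)
    \<Rightarrow> ('k \<Rightarrow> 'c::ab_group_add \<Rightarrow> 'c) \<Rightarrow> ('a \<Rightarrow> 'b \<Rightarrow> 'c) \<Rightarrow> bool" where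
  "bilinear_map sA sB sC B \<longleftrightarrow>
     (\<forall>a. Vector_Spaces.linear sB sC (B a)) \<and> (\<forall>b. Vector_Spaces.linear sA sC (\<lambda>a. B a b))"

definition linear_to_tensor ::
  "('k::field \<Rightarrow> 'v::ab_group_add \<Rightarrow> 'v) \<Rightarrow> ('k \<Rightarrow> 'a::ab_group_add \<Rightarrow> 'a)
    \<Rightarrow> ('k \<Rightarrow> 'b::ab_group_add \<Rightarrow> 'b) \<Rightarrow> ('v \<Rightarrow> ('a \<times> 'b \<Rightarrow>\<^sub>0 'k)) \<Rightarrow> bool" where
  "linear_to_tensor sV sA sB \<phi> \<longleftrightarrow>
     (\<forall>x y. tensor_eq sA sB (\<phi> (x + y)) (\<phi> x + \<phi> y)) \<and>
     (\<forall>c x. tensor_eq sA sB (\<phi> (sV c x)) (fscale c (\<phi> x)))"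


section \<open>Algebras, coalgebras, Hopf algebras\<close>

locale assoc_algebra = vector_space s
  for s :: "'k::field \<Rightarrow> 'a::ab_group_add \<Rightarrow> 'a" +
  fixes m :: "'a \<Rightarrow> 'a \<Rightarrow> 'a"
  assumes mult_bilinear: "bilinear_map s s s m"
    and mult_assoc: "m (m x y) z = m x (m y z)"

locale unital_algebra = assoc_algebra s m
  for s :: "'k::field \<Rightarrow> 'a::ab_group_add \<Rightarrow> 'a" and m +
  fixes u :: 'a
  assumes unit_left: "m u x = x" and unit_right: "m x u = x"

locale coalgebra = vector_space s
  for s :: "'k::field \<Rightarrow> 'a::ab_group_add \<Rightarrow> 'a" +
  fixes \<Delta> :: "'a \<Rightarrow> ('a \<times> 'a \<Rightarrow>\<^sub>0 'k)" and \<epsilon> :: "'a \<Rightarrow> 'k"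
  assumes comult_linear: "linear_to_tensor s s s \<Delta>"
    and counit_linear: "Vector_Spaces.linear s (*) \<epsilon>"
    and coassoc: "tensor3_eq s s s (expand_left \<Delta> (\<Delta> x)) (expand_right \<Delta> (\<Delta> x))"
    and counit_left: "lin_ext s (\<lambda>(a, b). s (\<epsilon> a) b) (\<Delta> x) = x"
    and counit_right: "lin_ext s (\<lambda>(a, b). s (\<epsilon> b) a) (\<Delta> x) = x"

locale graded_space = vector_space s
  for s :: "'k::field \<Rightarrow> 'a::ab_group_add \<Rightarrow> 'a" +
  fixes G :: "nat \<Rightarrow> 'a set"
  assumes grade_subspace: "subspace (G n)"
    and direct_sum: "\<exists>!c. (\<forall>n. c n \<in> G n) \<and> finite {n. c n \<noteq> 0} \<and> x = (\<Sum>n | c n \<noteq> 0. c n)"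

text \<open>Degree preservation of the coproduct means
  \<open>\<Delta>(G\<^sub>n) \<subseteq> \<Sum>\<^bsub>i+j=n\<^esub> G\<^sub>i \<otimes> G\<^sub>j\<close>.\<close>

locale graded_coalgebra = coalgebra s \<Delta> \<epsilon> + graded_space s G
  for s :: "'k::field \<Rightarrow> 'a::ab_group_add \<Rightarrow> 'a" and \<Delta> \<epsilon> G +
  assumes comult_graded:
      "x \<in> G n \<Longrightarrow> \<exists>u. tensor_eq s s (\<Delta> x) u \<and>
         Poly_Mapping.keys u \<subseteq> (\<Union>(i, j) \<in> {(i, j). i + j = n}. G i \<times> G j)"
    and counit_graded: "x \<in> G n \<Longrightarrow> 0 < n \<Longrightarrow> \<epsilon> x = 0"

locale connected_graded_coalgebra = graded_coalgebra s \<Delta> \<epsilon> G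
  for s :: "'k::field \<Rightarrow> 'a::ab_group_add \<Rightarrow> 'a" and \<Delta> \<epsilon> G +
  assumes connected: "dim (G 0) = 1"

locale bialgebra = unital_algebra s m u + coalgebra s \<Delta> \<epsilon>
  for s :: "'k::field \<Rightarrow> 'a::ab_group_add \<Rightarrow> 'a" and m u \<Delta> \<epsilon> +
  assumes comult_mult: "tensor_eq s s (\<Delta> (m x y)) (tprod m m (\<Delta> x) (\<Delta> y))"
    and comult_unit: "tensor_eq s s (\<Delta> u) (gen (u, u))"
    and counit_mult: "\<epsilon> (m x y) = \<epsilon> x * \<epsilon> y"
    and counit_unit: "\<epsilon> u = 1"

definition left_antipode where
  "left_antipode s m u \<Delta> \<epsilon> S \<longleftrightarrow> Vector_Spaces.linear s s S \<and>
     (\<forall>x. lin_ext s (\<lambda>(a, b). m (S a) b) (\<Delta> x) = s (\<epsilon> x) u)"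

definition right_antipode where
  "right_antipode s m u \<Delta> \<epsilon> S \<longleftrightarrow> Vector_Spaces.linear s s S \<and>
     (\<forall>x. lin_ext s (\<lambda>(a, b). m a (S b)) (\<Delta> x) = s (\<epsilon> x) u)"

locale hopf_algebra = bialgebra s m u \<Delta> \<epsilon>
  for s :: "'k::field \<Rightarrow> 'a::ab_group_add \<Rightarrow> 'a" and m u \<Delta> \<epsilon> +
  assumes antipode: "\<exists>S. left_antipode s m u \<Delta> \<epsilon> S \<and> right_antipode s m u \<Delta> \<epsilon> S"

locale connected_graded_hopf_algebra =
  hopf_algebra s m u \<Delta> \<epsilon> + connected_graded_coalgebra s \<Delta> \<epsilon> G
  for s :: "'k::field \<Rightarrow> 'a::ab_group_add \<Rightarrow> 'a" and m u \<Delta> \<epsilon> G +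
  assumes mult_graded: "x \<in> G i \<Longrightarrow> y \<in> G j \<Longrightarrow> m x y \<in> G (i + j)"
    and unit_graded: "u \<in> G 0"

locale one_sided_hopf_base = coalgebra s \<Delta> \<epsilon> + assoc_algebra s m
  for s :: "'k::field \<Rightarrow> 'a::ab_group_add \<Rightarrow> 'a" and m \<Delta> \<epsilon> +
  assumes comult_mult: "tensor_eq s s (\<Delta> (m x y)) (tprod m m (\<Delta> x) (\<Delta> y))"
    and counit_mult: "\<epsilon> (m x y) = \<epsilon> x * \<epsilon> y"

definition one_sided_hopf_algebra where
  "one_sided_hopf_algebra s m u \<Delta> \<epsilon> \<longleftrightarrow> one_sided_hopf_base s m \<Delta> \<epsilon> \<and>
     ((\<forall>x. m x u = x) \<and> (\<exists>S. left_antipode s m u \<Delta> \<epsilon> S) \<or>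
      (\<forall>x. m u x = x) \<and> (\<exists>S. right_antipode s m u \<Delta> \<epsilon> S))"


section \<open>Modules, comodules, Hopf modules\<close>

text \<open>In the following, \<open>sD mD uD \<Delta>D \<epsilon>D GD\<close> belong to \<open>\<D>\<close> and \<open>sE \<Delta>E \<epsilon>E GE\<close> to \<open>\<E>\<close>.\<close>

locale right_module = D: unital_algebra sD mD uD + E: vector_space sE
  for sD :: "'k::field \<Rightarrow> 'd::ab_group_add \<Rightarrow> 'd" and mD uD
    and sE :: "'k \<Rightarrow> 'e::ab_group_add \<Rightarrow> 'e" +
  fixes act :: "'e \<Rightarrow> 'd \<Rightarrow> 'e"
  assumes act_bilinear: "bilinear_map sE sD sE act"
    and act_assoc: "act (act e d) d' = act e (mD d d')"
    and act_unit: "act e uD = e"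

locale left_module = D: unital_algebra sD mD uD + E: vector_space sE
  for sD :: "'k::field \<Rightarrow> 'd::ab_group_add \<Rightarrow> 'd" and mD uD
    and sE :: "'k \<Rightarrow> 'e::ab_group_add \<Rightarrow> 'e" +
  fixes act :: "'d \<Rightarrow> 'e \<Rightarrow> 'e"
  assumes act_bilinear: "bilinear_map sD sE sE act"
    and act_assoc: "act d (act d' e) = act (mD d d') e"
    and act_unit: "act uD e = e"

locale comodule = D: coalgebra sD \<Delta>D \<epsilon>D + E: vector_space sE
  for sD :: "'k::field \<Rightarrow> 'd::ab_group_add \<Rightarrow> 'd" and \<Delta>D \<epsilon>D
    and sE :: "'k \<Rightarrow> 'e::ab_group_add \<Rightarrow> 'e" +
  fixes \<rho> :: "'e \<Rightarrow> ('e \<times> 'd \<Rightarrow>\<^sub>0 'k)"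
  assumes coact_linear: "linear_to_tensor sE sE sD \<rho>"
    and coact_coassoc: "tensor3_eq sE sD sD (expand_left \<rho> (\<rho> e)) (expand_right \<Delta>D (\<rho> e))"
    and coact_counit: "lin_ext sE (\<lambda>(a, d). sE (\<epsilon>D d) a) (\<rho> e) = e"

locale right_hopf_module = D: hopf_algebra sD mD uD \<Delta>D \<epsilon>D +
  right_module sD mD uD sE act + comodule sD \<Delta>D \<epsilon>D sE \<rho>
  for sD :: "'k::field \<Rightarrow> 'd::ab_group_add \<Rightarrow> 'd" and mD uD \<Delta>D \<epsilon>D
    and sE :: "'k \<Rightarrow> 'e::ab_group_add \<Rightarrow> 'e" and act \<rho> +
  assumes coact_act: "tensor_eq sE sD (\<rho> (act e d)) (tprod act mD (\<rho> e) (\<Delta>D d))"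

locale left_hopf_module = D: hopf_algebra sD mD uD \<Delta>D \<epsilon>D +
  left_module sD mD uD sE act + comodule sD \<Delta>D \<epsilon>D sE \<rho>
  for sD :: "'k::field \<Rightarrow> 'd::ab_group_add \<Rightarrow> 'd" and mD uD \<Delta>D \<epsilon>D
    and sE :: "'k \<Rightarrow> 'e::ab_group_add \<Rightarrow> 'e" and act \<rho> +
  assumes coact_act: "tensor_eq sE sD (\<rho> (act d e)) (tprod act mD (\<Delta>D d) (\<rho> e))"

text \<open>The algebra \<open>\<E>\<close> is associative, but its distinguished element \<open>uE\<close> is not required to be
  a two-sided unit: for connections it is only a one-sided one.\<close>

locale comodule_algebra = D: hopf_algebra sD mD uD \<Delta>D \<epsilon>D +
  E: assoc_algebra sE mE + comodule sD \<Delta>D \<epsilon>D sE \<rho>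
  for sD :: "'k::field \<Rightarrow> 'd::ab_group_add \<Rightarrow> 'd" and mD uD \<Delta>D \<epsilon>D
    and sE :: "'k \<Rightarrow> 'e::ab_group_add \<Rightarrow> 'e" and mE uE \<rho> +
  assumes coact_mult: "tensor_eq sE sD (\<rho> (mE e e')) (tprod mE mD (\<rho> e) (\<rho> e'))"
    and coact_unit: "tensor_eq sE sD (\<rho> uE) (gen (uE, uD))"


section \<open>Connections\<close>

locale graded_coalgebra_map =
  E: graded_coalgebra sE \<Delta>E \<epsilon>E GE + D: graded_coalgebra sD \<Delta>D \<epsilon>D GD
  for sE :: "'k::field \<Rightarrow> 'e::ab_group_add \<Rightarrow> 'e" and \<Delta>E \<epsilon>E GE
    and sD :: "'k \<Rightarrow> 'd::ab_group_add \<Rightarrow> 'd" and \<Delta>D \<epsilon>D GD +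
  fixes f :: "'e \<Rightarrow> 'd"
  assumes map_linear: "Vector_Spaces.linear sE sD f"
    and map_graded: "e \<in> GE n \<Longrightarrow> f e \<in> GD n"
    and map_comult: "tensor_eq sD sD (tmap f f (\<Delta>E e)) (\<Delta>D (f e))"
    and map_counit: "\<epsilon>D (f e) = \<epsilon>E e"

text \<open>Compatibility of the action with the counits is not assumed below; it follows from
  \<open>map_counit\<close>, \<open>map_act\<close> and the multiplicativity of the counit of \<open>\<D>\<close>.\<close>

locale right_connection =
  D: connected_graded_hopf_algebra sD mD uD \<Delta>D \<epsilon>D GD +
  E: connected_graded_coalgebra sE \<Delta>E \<epsilon>E GE +
  graded_coalgebra_map sE \<Delta>E \<epsilon>E GE sD \<Delta>D \<epsilon>D GD f +
  right_module sD mD uD sE act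
  for sD :: "'k::field \<Rightarrow> 'd::ab_group_add \<Rightarrow> 'd" and mD uD \<Delta>D \<epsilon>D GD
    and sE :: "'k \<Rightarrow> 'e::ab_group_add \<Rightarrow> 'e" and \<Delta>E \<epsilon>E GE act f +
  assumes act_graded: "e \<in> GE i \<Longrightarrow> d \<in> GD j \<Longrightarrow> act e d \<in> GE (i + j)"
    and comult_act: "tensor_eq sE sE (\<Delta>E (act e d)) (tprod act act (\<Delta>E e) (\<Delta>D d))"
    and map_act: "f (act e d) = mD (f e) d"

locale left_connection =
  D: connected_graded_hopf_algebra sD mD uD \<Delta>D \<epsilon>D GD +
  E: connected_graded_coalgebra sE \<Delta>E \<epsilon>E GE +
  graded_coalgebra_map sE \<Delta>E \<epsilon>E GE sD \<Delta>D \<epsilon>D GD f +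
  left_module sD mD uD sE act
  for sD :: "'k::field \<Rightarrow> 'd::ab_group_add \<Rightarrow> 'd" and mD uD \<Delta>D \<epsilon>D GD
    and sE :: "'k \<Rightarrow> 'e::ab_group_add \<Rightarrow> 'e" and \<Delta>E \<epsilon>E GE act f +
  assumes act_graded: "d \<in> GD i \<Longrightarrow> e \<in> GE j \<Longrightarrow> act d e \<in> GE (i + j)"
    and comult_act: "tensor_eq sE sE (\<Delta>E (act d e)) (tprod act act (\<Delta>D d) (\<Delta>E e))"
    and map_act: "f (act d e) = mD d (f e)"

definition right_prod :: "('e \<Rightarrow> 'd \<Rightarrow> 'e) \<Rightarrow> ('e \<Rightarrow> 'd) \<Rightarrow> 'e \<Rightarrow> 'e \<Rightarrow> 'e" where
  "right_prod act f e e' = act e (f e')"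

definition left_prod :: "('d \<Rightarrow> 'e \<Rightarrow> 'e) \<Rightarrow> ('e \<Rightarrow> 'd) \<Rightarrow> 'e \<Rightarrow> 'e \<Rightarrow> 'e" where
  "left_prod act f e e' = act (f e) e'"

definition coaction :: "('e \<Rightarrow> ('e \<times> 'e \<Rightarrow>\<^sub>0 'k::field)) \<Rightarrow> ('e \<Rightarrow> 'd) \<Rightarrow> 'e \<Rightarrow> ('e \<times> 'd \<Rightarrow>\<^sub>0 'k)" where
  "coaction \<Delta>E f e = tmap id f (\<Delta>E e)"

definition conn_unit :: "(nat \<Rightarrow> 'e set) \<Rightarrow> ('e \<Rightarrow> 'd) \<Rightarrow> 'd \<Rightarrow> 'e" where
  "conn_unit GE f uD = (THE e. e \<in> GE 0 \<and> f e = uD)"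

end

theory Submission
  imports Defs
begin

text \<open>
  Write \<open>1\<^sub>E\<close> for the distinguished element of \<open>\<E>\<close> and consider right modules; the left case is the mirror
  image. Every structure on \<open>\<E>\<close> comes from \<open>\<D>\<close> along \<open>f\<close>.

  The unit: on a connected graded coalgebra the counit restricts to an isomorphism of the degree-zero
  part with the ground field, since a counit that vanished there would vanish altogether. As \<open>f\<close>
  preserves degrees and counits, \<open>f e = 1\<close> means \<open>\<epsilon> e = 1\<close> for \<open>e\<close> of degree zero
  (\<open>map_eq_unit_iff\<close>). Such an element exists, is unique, and is grouplike, because its coproduct
  is a multiple of \<open>1\<^sub>E \<otimes> 1\<^sub>E\<close> whose factor is fixed by the counit law
  (\<open>comult_degree_zero\<close>). Hence \<open>\<rho> 1\<^sub>E = 1\<^sub>E \<otimes> 1\<close>.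

  The coaction: \<open>\<rho>\<close> is the coproduct with its second factor pushed along \<open>f\<close>, so its coassociativity
  is the image of that of \<open>\<Delta>\<^sub>E\<close> under \<open>id \<otimes> f \<otimes> f\<close>
  (\<open>coaction_comodule\<close>). Pushing the compatibility of \<open>\<Delta>\<^sub>E\<close> with the action forward along
  \<open>id \<otimes> f\<close> gives the Hopf module law (\<open>coaction_act\<close>). Since \<open>e \<cdot> e' = e \<star> f e'\<close>,
  putting \<open>d = f e'\<close> and replacing \<open>\<Delta>\<^sub>D (f e')\<close> by \<open>(f \<otimes> f) (\<Delta>\<^sub>E e')\<close> makes
  the coaction (\<open>coaction_mult\<close>) and the coproduct (\<open>comult_prod\<close>) multiplicative.

  The antipode: with \<open>S\<close> an antipode of \<open>\<D>\<close>, the map \<open>e \<mapsto> 1\<^sub>E \<star> S (f e)\<close> is a left antipode of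
  \<open>\<E>\<close>. Indeed the sum of \<open>(1\<^sub>E \<star> S (f e')) \<star> f e''\<close> over the coproduct of \<open>e\<close> is
  \<open>1\<^sub>E \<star> \<Sum> S (f e') (f e'')\<close>, and \<open>f\<close> carries the coproduct of \<open>e\<close> to that of \<open>f e\<close>; the
  antipode law of \<open>\<D>\<close> leaves the multiple \<open>\<epsilon> (f e) = \<epsilon> e\<close> of \<open>1\<^sub>E\<close> (\<open>left_antipode_transfer\<close>).

  Tensors are formal sums compared modulo the bilinearity relations. An identity between operations on
  formal sums often holds on the nose, by composing linear extensions (\<open>lin_ext_lin_ext\<close>). The
  tensor relation enters through congruence lemmas, which rest on linear extensions sending relators
  into a given subspace (\<open>lin_ext_mod_span\<close>).
\<close>

section \<open>Linear extension modulo a subspace\<close>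

interpretation free: vector_space fscale
  by (rule vector_space_fscale)

context vector_space
begin

lemma lin_ext_superset:
  assumes "finite A" "Poly_Mapping.keys u \<subseteq> A"
  shows "lin_ext scale B u = (\<Sum>x\<in>A. Poly_Mapping.lookup u x *s B x)"
  unfolding lin_ext_def
  by (rule sum.mono_neutral_left) (use assms in \<open>auto simp: in_keys_iff\<close>)

lemma linear_lin_ext: "Vector_Spaces.linear fscale scale (lin_ext scale B)"
proof -
  have add: "lin_ext scale B (u + v) = lin_ext scale B u + lin_ext scale B v" for u v
  proof -
    let ?A = "Poly_Mapping.keys u \<union> Poly_Mapping.keys v"
    have "Poly_Mapping.keys (u + v) \<subseteq> ?A" by (rule Poly_Mapping.keys_add)
    then show ?thesis
      by (simp add: lin_ext_superset[of ?A] lookup_add scale_left_distrib sum.distrib)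
  qed
  have scl: "lin_ext scale B (fscale c u) = c *s lin_ext scale B u" for c u
  proof -
    have "Poly_Mapping.keys (fscale c u) \<subseteq> Poly_Mapping.keys u"
      by (auto simp: in_keys_iff lookup_fscale)
    then show ?thesis
      by (simp add: lin_ext_superset[of "Poly_Mapping.keys u"] lookup_fscale scale_sum_right)
  qed
  show ?thesis by unfold_locales (simp_all add: add scl)
qed

lemma lin_ext_gen [simp]: "lin_ext scale B (gen x) = B x"
  by (simp add: lin_ext_def gen_def)

lemmas lin_ext_zero = module_hom.zero[OF linear_lin_ext[unfolded linear_iff_module_hom]]
  and lin_ext_add = module_hom.add[OF linear_lin_ext[unfolded linear_iff_module_hom]]
  and lin_ext_diff = module_hom.diff[OF linear_lin_ext[unfolded linear_iff_module_hom]]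
  and lin_ext_scale = module_hom.scale[OF linear_lin_ext[unfolded linear_iff_module_hom]]

lemma lin_ext_swap:
  "lin_ext scale (\<lambda>x. lin_ext scale (B x) v) u = lin_ext scale (\<lambda>y. lin_ext scale (\<lambda>x. B x y) u) v"
  unfolding lin_ext_def scale_sum_right
  by (subst sum.swap) (simp add: mult.commute)

lemma lin_ext_mod_cong:
  assumes "subspace W" "\<And>x. x \<in> Poly_Mapping.keys u \<Longrightarrow> B x - C x \<in> W"
  shows "lin_ext scale B u - lin_ext scale C u \<in> W"
proof -
  have "lin_ext scale B u - lin_ext scale C u
      = (\<Sum>x\<in>Poly_Mapping.keys u. Poly_Mapping.lookup u x *s (B x - C x))"
    by (simp add: lin_ext_def sum_subtractf scale_right_diff_distrib)
  also have "\<dots> \<in> W" using assms by (intro subspace_sum subspace_scale)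
  finally show ?thesis .
qed

text \<open>Compatibility with relators in general form. Working modulo a subspace \<open>W\<close> of the target covers two
  uses: \<open>W = {0}\<close> for maps from a tensor product to a vector space, and \<open>W\<close> spanned by relators
  for maps between tensor products.\<close>

lemma lin_ext_mod_span:
  assumes "subspace W" "\<And>r. r \<in> R \<Longrightarrow> lin_ext scale B r \<in> W" "u - v \<in> module.span fscale R"
  shows "lin_ext scale B u - lin_ext scale B v \<in> W"
proof -
  have "free.subspace {w. lin_ext scale B w \<in> W}"
    unfolding free.subspace_def using assms(1)
    by (auto simp: lin_ext_add lin_ext_scale lin_ext_zero subspace_0 subspace_add subspace_scale)
  moreover have "R \<subseteq> {w. lin_ext scale B w \<in> W}" using assms(2) by blast
  ultimately have "free.span R \<subseteq> {w. lin_ext scale B w \<in> W}" by (intro free.span_minimal)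
  with assms(3) have "lin_ext scale B (u - v) \<in> W" by blast
  then show ?thesis by (simp add: lin_ext_diff)
qed

lemma lin_ext_mod_tensor:
  assumes "subspace W"
    and "\<And>a a' b. B (a + a', b) - B (a, b) - B (a', b) \<in> W"
    and "\<And>a b b'. B (a, b + b') - B (a, b) - B (a, b') \<in> W"
    and "\<And>c a b. B (sA c a, b) - c *s B (a, b) \<in> W"
    and "\<And>c a b. B (a, sB c b) - c *s B (a, b) \<in> W"
    and "tensor_eq sA sB u v"
  shows "lin_ext scale B u - lin_ext scale B v \<in> W"
  by (rule lin_ext_mod_span[OF assms(1) _ assms(6)[unfolded tensor_eq_def]])
    (auto simp: tensor_relators_def lin_ext_diff lin_ext_scale assms(2-5))

lemma lin_ext_mod_tensor3:
  assumes "subspace W"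
    and "\<And>a a' b c. B (a + a', b, c) - B (a, b, c) - B (a', b, c) \<in> W"
    and "\<And>a b b' c. B (a, b + b', c) - B (a, b, c) - B (a, b', c) \<in> W"
    and "\<And>a b c c'. B (a, b, c + c') - B (a, b, c) - B (a, b, c') \<in> W"
    and "\<And>k a b c. B (sA k a, b, c) - k *s B (a, b, c) \<in> W"
    and "\<And>k a b c. B (a, sB k b, c) - k *s B (a, b, c) \<in> W"
    and "\<And>k a b c. B (a, b, sC k c) - k *s B (a, b, c) \<in> W"
    and "tensor3_eq sA sB sC u v"
  shows "lin_ext scale B u - lin_ext scale B v \<in> W"
  by (rule lin_ext_mod_span[OF assms(1) _ assms(8)[unfolded tensor3_eq_def]])
    (auto simp: tensor3_relators_def lin_ext_diff lin_ext_scale assms(2-7))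

end

lemma linear_apply_lin_ext:
  assumes "Vector_Spaces.linear s t g"
  shows "g (lin_ext s B u) = lin_ext t (\<lambda>x. g (B x)) u"
proof -
  interpret Vector_Spaces.linear s t g by fact
  show ?thesis by (simp add: lin_ext_def sum scale)
qed

lemma (in vector_space) lin_ext_lin_ext:
  "lin_ext scale B (lin_ext fscale C u) = lin_ext scale (\<lambda>x. lin_ext scale B (C x)) u"
  by (rule linear_apply_lin_ext[OF linear_lin_ext])

lemma lin_ext_gen_id: "lin_ext fscale gen u = u"
proof (rule poly_mapping_eqI)
  fix x
  have "Poly_Mapping.lookup (lin_ext fscale gen u) x
      = (\<Sum>y\<in>Poly_Mapping.keys u. if y = x then Poly_Mapping.lookup u y else 0)"
    unfolding lin_ext_def lookup_sum
    by (rule sum.cong) (auto simp: lookup_fscale gen_def lookup_single when_def)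
  also have "\<dots> = Poly_Mapping.lookup u x" by (auto simp: in_keys_iff)
  finally show "Poly_Mapping.lookup (lin_ext fscale gen u) x = Poly_Mapping.lookup u x" .
qed

section \<open>Operations on tensor products\<close>

lemma bilinear_mapD:
  assumes "bilinear_map sA sB sC B"
  shows "Vector_Spaces.linear sB sC (B a)" "Vector_Spaces.linear sA sC (\<lambda>a. B a b)"
  using assms by (auto simp: bilinear_map_def)

lemma linearD:
  assumes "Vector_Spaces.linear s t g"
  shows "g (x + y) = g x + g y" "g (s c x) = t c (g x)"
  using module_hom.add[OF assms[unfolded linear_iff_module_hom]]
    module_hom.scale[OF assms[unfolded linear_iff_module_hom]] by auto

lemmas bilinearD = linearD[OF bilinear_mapD(1)] linearD[OF bilinear_mapD(2)]

lemma tensor_eq_sym: "tensor_eq sA sB u v \<Longrightarrow> tensor_eq sA sB v u"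
  unfolding tensor_eq_def using free.span_neg by fastforce

lemma tensor_eq_trans [trans]:
  "tensor_eq sA sB u v \<Longrightarrow> tensor_eq sA sB v w \<Longrightarrow> tensor_eq sA sB u w"
  unfolding tensor_eq_def using free.span_add[of "u - v" _ "v - w"] by simp

lemma tensor3_eq_trans [trans]:
  "tensor3_eq sA sB sC u v \<Longrightarrow> tensor3_eq sA sB sC v w \<Longrightarrow> tensor3_eq sA sB sC u w"
  unfolding tensor3_eq_def using free.span_add[of "u - v" _ "v - w"] by simp

text \<open>The universal property of the tensor product: bilinear maps factor through it.\<close>

lemma tensor_eq_imp_lin_ext_eq:
  assumes "bilinear_map sA sB sC B" "tensor_eq sA sB u v"
  shows "lin_ext sC (\<lambda>(a, b). B a b) u = lin_ext sC (\<lambda>(a, b). B a b) v"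
proof -
  interpret vector_space sC
    using bilinear_mapD(1)[OF assms(1)] by (simp add: Vector_Spaces.linear_def)
  have "lin_ext sC (\<lambda>(a, b). B a b) u - lin_ext sC (\<lambda>(a, b). B a b) v \<in> {0}"
    by (rule lin_ext_mod_tensor[OF _ _ _ _ _ assms(2)])
      (simp_all add: bilinearD[OF assms(1)] subspace_single_0)
  then show ?thesis by simp
qed

lemma tensor_relatorsI:
  "gen (a + a', b) - gen (a, b) - gen (a', b) \<in> tensor_relators sA sB"
  "gen (a, b + b') - gen (a, b) - gen (a, b') \<in> tensor_relators sA sB"
  "gen (sA c a, b) - fscale c (gen (a, b)) \<in> tensor_relators sA sB"
  "gen (a, sB c b) - fscale c (gen (a, b)) \<in> tensor_relators sA sB"
  unfolding tensor_relators_def by blast+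

lemma tensor3_relatorsI:
  "gen (a + a', b, c) - gen (a, b, c) - gen (a', b, c) \<in> tensor3_relators sA sB sC"
  "gen (a, b + b', c) - gen (a, b, c) - gen (a, b', c) \<in> tensor3_relators sA sB sC"
  "gen (a, b, c + c') - gen (a, b, c) - gen (a, b, c') \<in> tensor3_relators sA sB sC"
  "gen (sA k a, b, c) - fscale k (gen (a, b, c)) \<in> tensor3_relators sA sB sC"
  "gen (a, sB k b, c) - fscale k (gen (a, b, c)) \<in> tensor3_relators sA sB sC"
  "gen (a, b, sC k c) - fscale k (gen (a, b, c)) \<in> tensor3_relators sA sB sC"
proof -
  show "gen (a + a', b, c) - gen (a, b, c) - gen (a', b, c) \<in> tensor3_relators sA sB sC"
    unfolding tensor3_relators_def by (rule UnI1)+ (rule CollectI, (rule exI)+, rule conjI[OF refl TrueI])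
  show "gen (a, b + b', c) - gen (a, b, c) - gen (a, b', c) \<in> tensor3_relators sA sB sC"
    unfolding tensor3_relators_def
    by (rule UnI1, rule UnI1, rule UnI1, rule UnI1, rule UnI2) (rule CollectI, (rule exI)+, rule conjI[OF refl TrueI])
  show "gen (a, b, c + c') - gen (a, b, c) - gen (a, b, c') \<in> tensor3_relators sA sB sC"
    unfolding tensor3_relators_def by (rule UnI1, rule UnI1, rule UnI1, rule UnI2) (rule CollectI, (rule exI)+, rule conjI[OF refl TrueI])
  show "gen (sA k a, b, c) - fscale k (gen (a, b, c)) \<in> tensor3_relators sA sB sC"
    unfolding tensor3_relators_def by (rule UnI1, rule UnI1, rule UnI2) (rule CollectI, (rule exI)+, rule conjI[OF refl TrueI])
  show "gen (a, sB k b, c) - fscale k (gen (a, b, c)) \<in> tensor3_relators sA sB sC"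
    unfolding tensor3_relators_def by (rule UnI1, rule UnI2) (rule CollectI, (rule exI)+, rule conjI[OF refl TrueI])
  show "gen (a, b, sC k c) - fscale k (gen (a, b, c)) \<in> tensor3_relators sA sB sC"
    unfolding tensor3_relators_def by (rule UnI2) (rule CollectI, (rule exI)+, rule conjI[OF refl TrueI])
qed

lemma tmap_cong:
  assumes "Vector_Spaces.linear sA sP g" "Vector_Spaces.linear sB sQ h" "tensor_eq sA sB u v"
  shows "tensor_eq sP sQ (tmap g h u) (tmap g h v)"
  unfolding tensor_eq_def tmap_def
  by (rule free.lin_ext_mod_tensor[OF free.subspace_span _ _ _ _ assms(3)];
      simp add: linearD[OF assms(1)] linearD[OF assms(2)] free.span_base tensor_relatorsI)

definition tmap3 :: "('a \<Rightarrow> 'p) \<Rightarrow> ('b \<Rightarrow> 'q) \<Rightarrow> ('c \<Rightarrow> 'r)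
    \<Rightarrow> ('a \<times> 'b \<times> 'c \<Rightarrow>\<^sub>0 'k::field) \<Rightarrow> ('p \<times> 'q \<times> 'r \<Rightarrow>\<^sub>0 'k)" where
  "tmap3 g h l = lin_ext fscale (\<lambda>(a, b, c). gen (g a, h b, l c))"

lemma tmap3_cong:
  assumes "Vector_Spaces.linear sA sP g" "Vector_Spaces.linear sB sQ h"
    "Vector_Spaces.linear sC sR l" "tensor3_eq sA sB sC u v"
  shows "tensor3_eq sP sQ sR (tmap3 g h l u) (tmap3 g h l v)"
  unfolding tensor3_eq_def tmap3_def
  by (rule free.lin_ext_mod_tensor3[OF free.subspace_span _ _ _ _ _ _ assms(4)];
      simp add: linearD[OF assms(1)] linearD[OF assms(2)] linearD[OF assms(3)]
        free.span_base tensor3_relatorsI)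

text \<open>With the left factor a fixed formal sum, the componentwise product is a linear combination of
  maps \<open>m a \<otimes> m' b\<close>, so that congruence of \<open>tmap\<close> suffices.\<close>

lemma tprod_cong_right:
  assumes "bilinear_map sA sC sP m" "bilinear_map sB sD sQ m'" "tensor_eq sC sD v w"
  shows "tensor_eq sP sQ (tprod m m' u v) (tprod m m' u w)"
proof -
  have "tprod m m' u x = lin_ext fscale (\<lambda>(a, b). tmap (m a) (m' b) x) u" for x
    by (simp add: tprod_def tmap_def)
  moreover have "tensor_eq sP sQ (tmap (m a) (m' b) v) (tmap (m a) (m' b) w)" for a b
    by (rule tmap_cong[OF bilinear_mapD(1)[OF assms(1)] bilinear_mapD(1)[OF assms(2)] assms(3)])
  ultimately show ?thesis
    unfolding tensor_eq_def by (auto intro!: free.lin_ext_mod_cong[OF free.subspace_span])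
qed

lemma tprod_flip: "tprod m m' u v = tprod (\<lambda>c a. m a c) (\<lambda>d b. m' b d) v u"
  unfolding tprod_def by (simp add: case_prod_unfold free.lin_ext_swap[of _ v u])

lemma bilinear_map_flip: "bilinear_map sA sB sC m \<Longrightarrow> bilinear_map sB sA sC (\<lambda>b a. m a b)"
  by (simp add: bilinear_map_def)

lemma tprod_cong_left:
  assumes "bilinear_map sA sC sP m" "bilinear_map sB sD sQ m'" "tensor_eq sA sB u v"
  shows "tensor_eq sP sQ (tprod m m' u w) (tprod m m' v w)"
  unfolding tprod_flip[of m m' _ w]
  by (rule tprod_cong_right[OF bilinear_map_flip bilinear_map_flip]) (fact assms)+

text \<open>This is what lets a coproduct inside a coassociativity law be replaced by another representative of the
  same tensor.\<close>

lemma expand_right_cong: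
  assumes "\<And>b. tensor_eq sP sQ (\<phi> b) (\<psi> b)"
  shows "tensor3_eq sA sP sQ (expand_right \<phi> u) (expand_right \<psi> u)"
proof -
  have "lin_ext fscale (\<lambda>(p, q). gen (a, p, q)) (\<phi> b) - lin_ext fscale (\<lambda>(p, q). gen (a, p, q)) (\<psi> b)
      \<in> free.span (tensor3_relators sA sP sQ)" for a b
    by (rule free.lin_ext_mod_tensor[OF free.subspace_span _ _ _ _ assms[of b]];
      simp add: free.span_base tensor3_relatorsI)
  then show ?thesis unfolding tensor3_eq_def expand_right_def
    by (intro free.lin_ext_mod_cong[OF free.subspace_span]) auto
qed

section \<open>The degree-zero part of a connected coalgebra\<close>

context connected_graded_coalgebra
begin

lemma degree_zero_line: "\<exists>b. b \<noteq> 0 \<and> G 0 = range (\<lambda>c. s c b)"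
proof -
  obtain B where B: "B \<subseteq> G 0" "independent B" "G 0 \<subseteq> span B" "card B = dim (G 0)"
    using basis_exists[of "G 0"] by blast
  then obtain b where b: "B = {b}" using connected card_1_singletonE by metis
  have "span B \<subseteq> G 0" by (rule span_minimal[OF B(1) grade_subspace])
  with B b have "G 0 = range (\<lambda>c. s c b)" by (simp add: span_singleton)
  moreover have "b \<noteq> 0" using B(2) b dependent_zero by blast
  ultimately show ?thesis by blast
qed

text \<open>If the counit, which vanishes in positive degrees, did so in degree zero, it would be zero, and the counit law would make
  every element zero, contrary to the degree-zero part being a line.\<close>

lemma counit_nonzero_on_degree_zero: "\<exists>x\<in>G 0. \<epsilon> x \<noteq> 0"
proof (rule ccontr)
  assume neg: "\<not> ?thesis"
  interpret ce: Vector_Spaces.linear s "(*)" \<epsilon> by (rule counit_linear)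
  have on_grade: "\<epsilon> y = 0" if "y \<in> G n" for y n
    using neg counit_graded[OF that] that by (cases "n = 0") auto
  have zero: "\<epsilon> x = 0" for x
  proof -
    obtain c where c: "\<forall>n. c n \<in> G n" "x = (\<Sum>n | c n \<noteq> 0. c n)"
      using direct_sum[of x] by blast
    have "\<epsilon> x = (\<Sum>n | c n \<noteq> 0. \<epsilon> (c n))" by (subst c(2)) (rule ce.sum)
    also have "\<dots> = 0" using c(1) on_grade by (intro sum.neutral) blast
    finally show ?thesis .
  qed
  obtain b :: 'a where "b \<noteq> 0" using degree_zero_line by blast
  moreover have "b = 0"
    using counit_left[of b] by (simp add: zero lin_ext_def case_prod_unfold)
  ultimately show False by simp
qed

lemma degree_zero_eq:
  assumes "u \<in> G 0" "\<epsilon> u = 1" "x \<in> G 0"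
  shows "x = s (\<epsilon> x) u"
proof -
  obtain b where "G 0 = range (\<lambda>c. s c b)" using degree_zero_line by blast
  with assms obtain c d where "u = s c b" "x = s d b" by blast
  moreover from this have "\<epsilon> b * c = 1"
    using assms(2) by (simp add: linearD[OF counit_linear] mult.commute)
  ultimately show ?thesis by (simp add: linearD[OF counit_linear] mult.assoc)
qed

lemma degree_zero_unique: "\<exists>!u. u \<in> G 0 \<and> \<epsilon> u = 1"
proof -
  interpret ce: Vector_Spaces.linear s "(*)" \<epsilon> by (rule counit_linear)
  obtain b where b: "b \<in> G 0" "\<epsilon> b \<noteq> 0" using counit_nonzero_on_degree_zero by blast
  show ?thesis
  proof (rule ex_ex1I)
    show "\<exists>u. u \<in> G 0 \<and> \<epsilon> u = 1"
      using b by (intro exI[of _ "s (1 / \<epsilon> b) b"]) (simp add: ce.scale subspace_scale[OF grade_subspace])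
    show "u = v" if "u \<in> G 0 \<and> \<epsilon> u = 1" "v \<in> G 0 \<and> \<epsilon> v = 1" for u v
      using degree_zero_eq[of v u] that by simp
  qed
qed

lemma tensor_eq_degree_zero:
  assumes u: "u \<in> G 0" "\<epsilon> u = 1" and ab: "a \<in> G 0" "b \<in> G 0"
  shows "tensor_eq s s (gen (a, b)) (fscale (\<epsilon> a * \<epsilon> b) (gen (u, u)))"
proof -
  define x y where "x = \<epsilon> a" and "y = \<epsilon> b"
  have eq: "a = s x u" "b = s y u"
    using degree_zero_eq[OF u] ab by (auto simp: x_def y_def)
  have rel: "gen (s x u, s y u) - fscale x (gen (u, s y u)) \<in> tensor_relators s s"
    "gen (u, s y u) - fscale y (gen (u, u)) \<in> tensor_relators s s"
    by (rule tensor_relatorsI)+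
  have "gen (s x u, s y u) - fscale x (gen (u, s y u)) + fscale x (gen (u, s y u) - fscale y (gen (u, u)))
      \<in> free.span (tensor_relators s s)"
    by (intro free.span_add free.span_scale free.span_base rel)
  then show ?thesis
    unfolding tensor_eq_def x_def[symmetric] y_def[symmetric] unfolding eq
    by (simp add: free.scale_right_diff_distrib)
qed

text \<open>Grading puts the coproduct of \<open>u\<close> in the tensor square of a line, so it is a multiple of
  \<open>u \<otimes> u\<close>. The factor is obtained by applying \<open>\<epsilon> \<otimes> \<epsilon>\<close>, which by the counit law yields
  \<open>\<epsilon> u = 1\<close>.\<close>

lemma comult_degree_zero:
  assumes u: "u \<in> G 0" "\<epsilon> u = 1"
  shows "tensor_eq s s (\<Delta> u) (gen (u, u))"
proof -
  obtain w where w: "tensor_eq s s (\<Delta> u) w" and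
    keys: "Poly_Mapping.keys w \<subseteq> (\<Union>(i, j) \<in> {(i, j). i + j = 0}. G i \<times> G j)"
    using comult_graded[OF u(1)] by blast
  have bil: "bilinear_map s s (*) (\<lambda>a b. \<epsilon> a * \<epsilon> b)"
    unfolding bilinear_map_def Vector_Spaces.linear_iff
    using counit_linear[unfolded Vector_Spaces.linear_iff] by (simp add: algebra_simps)
  have "tensor_eq s s (lin_ext fscale gen w)
          (lin_ext fscale (\<lambda>(a, b). fscale (\<epsilon> a * \<epsilon> b) (gen (u, u))) w)"
    unfolding tensor_eq_def
    by (rule free.lin_ext_mod_cong[OF free.subspace_span])
      (use keys tensor_eq_degree_zero[OF u] in \<open>auto simp: tensor_eq_def\<close>)
  moreover have "lin_ext fscale (\<lambda>(a, b). fscale (\<epsilon> a * \<epsilon> b) (gen (u, u))) w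
      = fscale (lin_ext (*) (\<lambda>(a, b). \<epsilon> a * \<epsilon> b) w) (gen (u, u))"
    by (simp add: lin_ext_def free.scale_sum_left case_prod_unfold)
  moreover have "lin_ext (*) (\<lambda>(a, b). \<epsilon> a * \<epsilon> b) w = lin_ext (*) (\<lambda>(a, b). \<epsilon> a * \<epsilon> b) (\<Delta> u)"
    using tensor_eq_imp_lin_ext_eq[OF bil w] by simp
  moreover have "lin_ext (*) (\<lambda>(a, b). \<epsilon> a * \<epsilon> b) (\<Delta> u) = \<epsilon> (lin_ext s (\<lambda>(a, b). s (\<epsilon> a) b) (\<Delta> u))"
    by (simp add: linear_apply_lin_ext[OF counit_linear] case_prod_unfold linearD[OF counit_linear])
  ultimately have "tensor_eq s s w (gen (u, u))"
    by (simp add: counit_left u lin_ext_gen_id)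
  with w show ?thesis by (rule tensor_eq_trans)
qed

end

section \<open>The coaction induced by a coalgebra map\<close>

text \<open>The data that do not depend on the side on which \<open>\<D>\<close> acts: they already determine the unit and the
  comodule structure.\<close>

locale connected_coalgebra_map =
  D: connected_graded_hopf_algebra sD mD uD \<Delta>D \<epsilon>D GD +
  E: connected_graded_coalgebra sE \<Delta>E \<epsilon>E GE +
  graded_coalgebra_map sE \<Delta>E \<epsilon>E GE sD \<Delta>D \<epsilon>D GD f
  for sD :: "'k::field \<Rightarrow> 'd::ab_group_add \<Rightarrow> 'd" and mD uD \<Delta>D \<epsilon>D GD
    and sE :: "'k \<Rightarrow> 'e::ab_group_add \<Rightarrow> 'e" and \<Delta>E \<epsilon>E GE f
begin

abbreviation "\<rho> \<equiv> coaction \<Delta>E f"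
abbreviation "uE \<equiv> conn_unit GE f uD"

text \<open>Both degree-zero parts are identified with the ground field by their counits, and \<open>f\<close> respects
  these identifications.\<close>

lemma map_eq_unit_iff:
  assumes "e \<in> GE 0"
  shows "f e = uD \<longleftrightarrow> \<epsilon>E e = 1"
proof
  assume "f e = uD" then show "\<epsilon>E e = 1" using map_counit[of e] D.counit_unit by simp
next
  assume "\<epsilon>E e = 1"
  then show "f e = uD"
    using D.degree_zero_eq[OF D.unit_graded D.counit_unit map_graded[OF assms]] map_counit[of e]
    by simp
qed

lemma unique_unit: "\<exists>!e. e \<in> GE 0 \<and> f e = uD"
  using E.degree_zero_unique map_eq_unit_iff by metis

lemma conn_unit_spec: "uE \<in> GE 0" "f uE = uD"
  using theI'[OF unique_unit] by (auto simp: conn_unit_def)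

lemma comult_unit: "tensor_eq sE sE (\<Delta>E uE) (gen (uE, uE))"
  using E.comult_degree_zero conn_unit_spec map_eq_unit_iff by blast

lemma linear_id: "Vector_Spaces.linear sE sE id"
  by (rule E.linear_id)

lemma coaction_unit: "tensor_eq sE sD (\<rho> uE) (gen (uE, uD))"
  using tmap_cong[OF linear_id map_linear comult_unit] conn_unit_spec
  by (simp add: coaction_def tmap_def)

text \<open>Coassociativity is the image under \<open>id \<otimes> f \<otimes> f\<close> of that of \<open>\<Delta>\<^sub>E\<close>. The compatibility of
  \<open>f\<close> with the coproducts then turns \<open>(f \<otimes> f) \<Delta>\<^sub>E\<close> into \<open>\<Delta>\<^sub>D f\<close> in the second factor of
  the outer coproduct.\<close>

lemma coaction_comodule: "comodule sD \<Delta>D \<epsilon>D sE \<rho>"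
proof unfold_locales
  show "linear_to_tensor sE sE sD \<rho>"
    unfolding linear_to_tensor_def
  proof (intro conjI allI)
    fix x y c
    show "tensor_eq sE sD (\<rho> (x + y)) (\<rho> x + \<rho> y)"
      using tmap_cong[OF linear_id map_linear, of "\<Delta>E (x + y)" "\<Delta>E x + \<Delta>E y"] E.comult_linear
      by (simp add: linear_to_tensor_def coaction_def tmap_def free.lin_ext_add)
    show "tensor_eq sE sD (\<rho> (sE c x)) (fscale c (\<rho> x))"
      using tmap_cong[OF linear_id map_linear, of "\<Delta>E (sE c x)" "fscale c (\<Delta>E x)"] E.comult_linear
      by (simp add: linear_to_tensor_def coaction_def tmap_def free.lin_ext_scale)
  qed
next
  fix e
  have "expand_left \<rho> (\<rho> e) = tmap3 id f f (expand_left \<Delta>E (\<Delta>E e))"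
    by (simp add: expand_left_def coaction_def tmap3_def tmap_def free.lin_ext_lin_ext case_prod_unfold)
  also have "tensor3_eq sE sD sD \<dots> (tmap3 id f f (expand_right \<Delta>E (\<Delta>E e)))"
    by (rule tmap3_cong[OF linear_id map_linear map_linear E.coassoc])
  also have "tmap3 id f f (expand_right \<Delta>E (\<Delta>E e)) = expand_right (\<lambda>b. tmap f f (\<Delta>E b)) (\<Delta>E e)"
    by (simp add: expand_right_def tmap3_def tmap_def free.lin_ext_lin_ext case_prod_unfold)
  also have "tensor3_eq sE sD sD \<dots> (expand_right (\<lambda>b. \<Delta>D (f b)) (\<Delta>E e))"
    by (rule expand_right_cong[OF map_comult])
  also have "expand_right (\<lambda>b. \<Delta>D (f b)) (\<Delta>E e) = expand_right \<Delta>D (\<rho> e)"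
    by (simp add: expand_right_def coaction_def tmap_def free.lin_ext_lin_ext case_prod_unfold)
  finally show "tensor3_eq sE sD sD (expand_left \<rho> (\<rho> e)) (expand_right \<Delta>D (\<rho> e))" .
next
  fix e
  show "lin_ext sE (\<lambda>(a, d). sE (\<epsilon>D d) a) (\<rho> e) = e"
    using E.counit_right[of e]
    by (simp add: coaction_def tmap_def E.lin_ext_lin_ext case_prod_unfold map_counit)
qed

text \<open>The sum over the coproduct of \<open>e\<close> in the antipode law becomes one over the coproduct of \<open>f e\<close>.\<close>

lemma lin_ext_comult_map:
  assumes "bilinear_map sD sD sD B"
  shows "lin_ext sD (\<lambda>(a, b). B (f a) (f b)) (\<Delta>E e) = lin_ext sD (\<lambda>(a, b). B a b) (\<Delta>D (f e))"
proof -
  have "lin_ext sD (\<lambda>(a, b). B (f a) (f b)) (\<Delta>E e) = lin_ext sD (\<lambda>(a, b). B a b) (tmap f f (\<Delta>E e))"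
    by (simp add: tmap_def D.lin_ext_lin_ext case_prod_unfold)
  also have "\<dots> = lin_ext sD (\<lambda>(a, b). B a b) (\<Delta>D (f e))"
    by (rule tensor_eq_imp_lin_ext_eq[OF assms map_comult])
  finally show ?thesis .
qed

end

lemma bilinear_map_comp:
  assumes "bilinear_map sA sB sC B" "Vector_Spaces.linear sP sA g" "Vector_Spaces.linear sQ sB h"
  shows "bilinear_map sP sQ sC (\<lambda>p q. B (g p) (h q))"
  using assms unfolding bilinear_map_def Vector_Spaces.linear_iff by simp

section \<open>Right and left connections\<close>

sublocale right_connection \<subseteq> connected_coalgebra_map
  by intro_locales

sublocale left_connection \<subseteq> connected_coalgebra_map
  by intro_locales

context right_connection
begin

abbreviation "mE \<equiv> right_prod act f"

lemma coaction_act: "tensor_eq sE sD (\<rho> (act e d)) (tprod act mD (\<rho> e) (\<Delta>D d))"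
proof -
  have "tmap id f (tprod act act (\<Delta>E e) (\<Delta>D d)) = tprod act mD (\<rho> e) (\<Delta>D d)"
    by (simp add: tmap_def tprod_def coaction_def free.lin_ext_lin_ext case_prod_unfold map_act)
  with tmap_cong[OF linear_id map_linear comult_act[of e d]] show ?thesis
    by (simp add: coaction_def)
qed

lemma hopf_module: "right_hopf_module sD mD uD \<Delta>D \<epsilon>D sE act \<rho>"
  by (intro right_hopf_module.intro right_hopf_module_axioms.intro coaction_comodule coaction_act
      D.hopf_algebra_axioms right_module_axioms)

lemma prod_assoc_algebra: "assoc_algebra sE mE"
  by unfold_locales
    (use bilinear_map_comp[OF act_bilinear E.linear_id map_linear] in
      \<open>simp_all add: right_prod_def[abs_def] act_assoc map_act\<close>)

text \<open>The Hopf module law for the element \<open>f e'\<close> of \<open>\<D>\<close>, whose coproduct is then rewritten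
  through \<open>f\<close>.\<close>

lemma coaction_mult: "tensor_eq sE sD (\<rho> (mE e e')) (tprod mE mD (\<rho> e) (\<rho> e'))"
proof -
  have "tensor_eq sE sD (\<rho> (mE e e')) (tprod act mD (\<rho> e) (\<Delta>D (f e')))"
    unfolding right_prod_def by (rule coaction_act)
  also have "tensor_eq sE sD \<dots> (tprod act mD (\<rho> e) (tmap f f (\<Delta>E e')))"
    by (rule tprod_cong_right[OF act_bilinear D.mult_bilinear tensor_eq_sym[OF map_comult]])
  also have "tprod act mD (\<rho> e) (tmap f f (\<Delta>E e')) = tprod mE mD (\<rho> e) (\<rho> e')"
    by (simp add: tmap_def tprod_def coaction_def free.lin_ext_lin_ext case_prod_unfold right_prod_def)
  finally show ?thesis .
qed

lemma comodule_algebra: "comodule_algebra sD mD uD \<Delta>D \<epsilon>D sE mE uE \<rho>"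
  by (intro comodule_algebra.intro comodule_algebra_axioms.intro coaction_comodule coaction_mult
      coaction_unit D.hopf_algebra_axioms prod_assoc_algebra)

lemma comult_prod: "tensor_eq sE sE (\<Delta>E (mE e e')) (tprod mE mE (\<Delta>E e) (\<Delta>E e'))"
proof -
  have "tensor_eq sE sE (\<Delta>E (mE e e')) (tprod act act (\<Delta>E e) (\<Delta>D (f e')))"
    unfolding right_prod_def by (rule comult_act)
  also have "tensor_eq sE sE \<dots> (tprod act act (\<Delta>E e) (tmap f f (\<Delta>E e')))"
    by (rule tprod_cong_right[OF act_bilinear act_bilinear tensor_eq_sym[OF map_comult]])
  also have "tprod act act (\<Delta>E e) (tmap f f (\<Delta>E e')) = tprod mE mE (\<Delta>E e) (\<Delta>E e')"
    by (simp add: tmap_def tprod_def free.lin_ext_lin_ext case_prod_unfold right_prod_def)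
  finally show ?thesis .
qed

lemma counit_prod: "\<epsilon>E (mE e e') = \<epsilon>E e * \<epsilon>E e'"
  by (simp add: right_prod_def map_act D.counit_mult flip: map_counit)

text \<open>By associativity of the action, the antipode sum at \<open>e\<close> is \<open>uE\<close> acted on by the antipode sum of
  \<open>\<D>\<close> at \<open>f e\<close>.\<close>

lemma left_antipode_transfer:
  assumes "left_antipode sD mD uD \<Delta>D \<epsilon>D S"
  shows "left_antipode sE mE uE \<Delta>E \<epsilon>E (\<lambda>e. act uE (S (f e)))"
proof -
  have S: "Vector_Spaces.linear sD sD S"
    and anti: "\<And>x. lin_ext sD (\<lambda>(a, b). mD (S a) b) (\<Delta>D x) = sD (\<epsilon>D x) uD"
    using assms by (auto simp: left_antipode_def)
  note act_lin = bilinear_mapD(1)[OF act_bilinear, of uE]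
  have "Vector_Spaces.linear sE sE (\<lambda>e. act uE (S (f e)))"
    using Vector_Spaces.linear_compose[OF Vector_Spaces.linear_compose[OF map_linear S] act_lin]
    by (simp add: comp_def)
  moreover have "lin_ext sE (\<lambda>(a, b). mE (act uE (S (f a))) b) (\<Delta>E e) = sE (\<epsilon>E e) uE" for e
  proof -
    have "lin_ext sE (\<lambda>(a, b). mE (act uE (S (f a))) b) (\<Delta>E e)
        = act uE (lin_ext sD (\<lambda>(a, b). mD (S (f a)) (f b)) (\<Delta>E e))"
      by (simp add: linear_apply_lin_ext[OF act_lin] case_prod_unfold right_prod_def act_assoc)
    also have "lin_ext sD (\<lambda>(a, b). mD (S (f a)) (f b)) (\<Delta>E e) = sD (\<epsilon>E e) uD"
      using lin_ext_comult_map[OF bilinear_map_comp[OF D.mult_bilinear S D.linear_id]]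
      by (simp add: anti map_counit)
    finally show ?thesis by (simp add: linearD[OF act_lin] act_unit)
  qed
  ultimately show ?thesis by (simp add: left_antipode_def)
qed

lemma one_sided_hopf: "one_sided_hopf_algebra sE mE uE \<Delta>E \<epsilon>E"
  unfolding one_sided_hopf_algebra_def
proof (intro conjI disjI1 allI)
  show "one_sided_hopf_base sE mE \<Delta>E \<epsilon>E"
    by (intro one_sided_hopf_base.intro one_sided_hopf_base_axioms.intro E.coalgebra_axioms
        prod_assoc_algebra comult_prod counit_prod)
  show "mE x uE = x" for x by (simp add: right_prod_def conn_unit_spec act_unit)
  show "\<exists>S. left_antipode sE mE uE \<Delta>E \<epsilon>E S"
    using D.antipode left_antipode_transfer by blast
qed

end

context left_connection
begin

abbreviation "mE \<equiv> left_prod act f"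

lemma coaction_act: "tensor_eq sE sD (\<rho> (act d e)) (tprod act mD (\<Delta>D d) (\<rho> e))"
proof -
  have "tmap id f (tprod act act (\<Delta>D d) (\<Delta>E e)) = tprod act mD (\<Delta>D d) (\<rho> e)"
    by (simp add: tmap_def tprod_def coaction_def free.lin_ext_lin_ext case_prod_unfold map_act)
  with tmap_cong[OF linear_id map_linear comult_act[of d e]] show ?thesis
    by (simp add: coaction_def)
qed

lemma hopf_module: "left_hopf_module sD mD uD \<Delta>D \<epsilon>D sE act \<rho>"
  by (intro left_hopf_module.intro left_hopf_module_axioms.intro coaction_comodule coaction_act
      D.hopf_algebra_axioms left_module_axioms)

lemma prod_assoc_algebra: "assoc_algebra sE mE"
  by unfold_locales
    (use bilinear_map_comp[OF act_bilinear map_linear E.linear_id] in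
      \<open>simp_all add: left_prod_def[abs_def] act_assoc map_act\<close>)

text \<open>The Hopf module law for the element \<open>f e\<close> of \<open>\<D>\<close>, whose coproduct is then rewritten
  through \<open>f\<close>.\<close>

lemma coaction_mult: "tensor_eq sE sD (\<rho> (mE e e')) (tprod mE mD (\<rho> e) (\<rho> e'))"
proof -
  have "tensor_eq sE sD (\<rho> (mE e e')) (tprod act mD (\<Delta>D (f e)) (\<rho> e'))"
    unfolding left_prod_def by (rule coaction_act)
  also have "tensor_eq sE sD \<dots> (tprod act mD (tmap f f (\<Delta>E e)) (\<rho> e'))"
    by (rule tprod_cong_left[OF act_bilinear D.mult_bilinear tensor_eq_sym[OF map_comult]])
  also have "tprod act mD (tmap f f (\<Delta>E e)) (\<rho> e') = tprod mE mD (\<rho> e) (\<rho> e')"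
    by (simp add: tmap_def tprod_def coaction_def free.lin_ext_lin_ext case_prod_unfold left_prod_def)
  finally show ?thesis .
qed

lemma comodule_algebra: "comodule_algebra sD mD uD \<Delta>D \<epsilon>D sE mE uE \<rho>"
  by (intro comodule_algebra.intro comodule_algebra_axioms.intro coaction_comodule coaction_mult
      coaction_unit D.hopf_algebra_axioms prod_assoc_algebra)

lemma comult_prod: "tensor_eq sE sE (\<Delta>E (mE e e')) (tprod mE mE (\<Delta>E e) (\<Delta>E e'))"
proof -
  have "tensor_eq sE sE (\<Delta>E (mE e e')) (tprod act act (\<Delta>D (f e)) (\<Delta>E e'))"
    unfolding left_prod_def by (rule comult_act)
  also have "tensor_eq sE sE \<dots> (tprod act act (tmap f f (\<Delta>E e)) (\<Delta>E e'))"
    by (rule tprod_cong_left[OF act_bilinear act_bilinear tensor_eq_sym[OF map_comult]])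
  also have "tprod act act (tmap f f (\<Delta>E e)) (\<Delta>E e') = tprod mE mE (\<Delta>E e) (\<Delta>E e')"
    by (simp add: tmap_def tprod_def free.lin_ext_lin_ext case_prod_unfold left_prod_def)
  finally show ?thesis .
qed

lemma counit_prod: "\<epsilon>E (mE e e') = \<epsilon>E e * \<epsilon>E e'"
  by (simp add: left_prod_def map_act D.counit_mult flip: map_counit)

text \<open>Here the antipode sum of \<open>\<D>\<close> at \<open>f e\<close> acts on \<open>uE\<close> from the left.\<close>

lemma right_antipode_transfer:
  assumes "right_antipode sD mD uD \<Delta>D \<epsilon>D S"
  shows "right_antipode sE mE uE \<Delta>E \<epsilon>E (\<lambda>e. act (S (f e)) uE)"
proof -
  have S: "Vector_Spaces.linear sD sD S"
    and anti: "\<And>x. lin_ext sD (\<lambda>(a, b). mD a (S b)) (\<Delta>D x) = sD (\<epsilon>D x) uD"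
    using assms by (auto simp: right_antipode_def)
  note act_lin = bilinear_mapD(2)[OF act_bilinear, of uE]
  have "Vector_Spaces.linear sE sE (\<lambda>e. act (S (f e)) uE)"
    using Vector_Spaces.linear_compose[OF Vector_Spaces.linear_compose[OF map_linear S] act_lin]
    by (simp add: comp_def)
  moreover have "lin_ext sE (\<lambda>(a, b). mE a (act (S (f b)) uE)) (\<Delta>E e) = sE (\<epsilon>E e) uE" for e
  proof -
    have "lin_ext sE (\<lambda>(a, b). mE a (act (S (f b)) uE)) (\<Delta>E e)
        = act (lin_ext sD (\<lambda>(a, b). mD (f a) (S (f b))) (\<Delta>E e)) uE"
      by (simp add: linear_apply_lin_ext[OF act_lin] case_prod_unfold left_prod_def act_assoc)
    also have "lin_ext sD (\<lambda>(a, b). mD (f a) (S (f b))) (\<Delta>E e) = sD (\<epsilon>E e) uD"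
      using lin_ext_comult_map[OF bilinear_map_comp[OF D.mult_bilinear D.linear_id S]]
      by (simp add: anti map_counit)
    finally show ?thesis by (simp add: linearD[OF act_lin] act_unit)
  qed
  ultimately show ?thesis by (simp add: right_antipode_def)
qed

lemma one_sided_hopf: "one_sided_hopf_algebra sE mE uE \<Delta>E \<epsilon>E"
  unfolding one_sided_hopf_algebra_def
proof (intro conjI disjI2 allI)
  show "one_sided_hopf_base sE mE \<Delta>E \<epsilon>E"
    by (intro one_sided_hopf_base.intro one_sided_hopf_base_axioms.intro E.coalgebra_axioms
        prod_assoc_algebra comult_prod counit_prod)
  show "mE uE x = x" for x by (simp add: left_prod_def conn_unit_spec act_unit)
  show "\<exists>S. right_antipode sE mE uE \<Delta>E \<epsilon>E S"
    using D.antipode right_antipode_transfer by blast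
qed

end

theorem theorem3p1:
  fixes sD :: "'k::field_char_0 \<Rightarrow> 'd::ab_group_add \<Rightarrow> 'd"
    and mD :: "'d \<Rightarrow> 'd \<Rightarrow> 'd" and uD :: 'd
    and \<Delta>D :: "'d \<Rightarrow> ('d \<times> 'd \<Rightarrow>\<^sub>0 'k)" and \<epsilon>D :: "'d \<Rightarrow> 'k" and GD :: "nat \<Rightarrow> 'd set"
    and sE :: "'k \<Rightarrow> 'e::ab_group_add \<Rightarrow> 'e"
    and \<Delta>E :: "'e \<Rightarrow> ('e \<times> 'e \<Rightarrow>\<^sub>0 'k)" and \<epsilon>E :: "'e \<Rightarrow> 'k" and GE :: "nat \<Rightarrow> 'e set"
    and ract :: "'e \<Rightarrow> 'd \<Rightarrow> 'e" and lact :: "'d \<Rightarrow> 'e \<Rightarrow> 'e"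
    and f :: "'e \<Rightarrow> 'd"
  assumes "connected_graded_hopf_algebra sD mD uD \<Delta>D \<epsilon>D GD"
  shows
    "(right_connection sD mD uD \<Delta>D \<epsilon>D GD sE \<Delta>E \<epsilon>E GE ract f \<longrightarrow>
       (\<exists>!e. e \<in> GE 0 \<and> f e = uD) \<and>
       right_hopf_module sD mD uD \<Delta>D \<epsilon>D sE ract (coaction \<Delta>E f) \<and>
       comodule_algebra sD mD uD \<Delta>D \<epsilon>D sE (right_prod ract f) (conn_unit GE f uD) (coaction \<Delta>E f) \<and>
       one_sided_hopf_algebra sE (right_prod ract f) (conn_unit GE f uD) \<Delta>E \<epsilon>E) \<and>
     (left_connection sD mD uD \<Delta>D \<epsilon>D GD sE \<Delta>E \<epsilon>E GE lact f \<longrightarrow>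
       (\<exists>!e. e \<in> GE 0 \<and> f e = uD) \<and>
       left_hopf_module sD mD uD \<Delta>D \<epsilon>D sE lact (coaction \<Delta>E f) \<and>
       comodule_algebra sD mD uD \<Delta>D \<epsilon>D sE (left_prod lact f) (conn_unit GE f uD) (coaction \<Delta>E f) \<and>
       one_sided_hopf_algebra sE (left_prod lact f) (conn_unit GE f uD) \<Delta>E \<epsilon>E)"
proof (intro conjI[where P = "_ \<longrightarrow> _"] impI)
  assume "right_connection sD mD uD \<Delta>D \<epsilon>D GD sE \<Delta>E \<epsilon>E GE ract f"
  then interpret right_connection sD mD uD \<Delta>D \<epsilon>D GD sE \<Delta>E \<epsilon>E GE ract f .
  show "(\<exists>!e. e \<in> GE 0 \<and> f e = uD) \<and>
       right_hopf_module sD mD uD \<Delta>D \<epsilon>D sE ract (coaction \<Delta>E f) \<and>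
       comodule_algebra sD mD uD \<Delta>D \<epsilon>D sE (right_prod ract f) (conn_unit GE f uD) (coaction \<Delta>E f) \<and>
       one_sided_hopf_algebra sE (right_prod ract f) (conn_unit GE f uD) \<Delta>E \<epsilon>E"
    by (intro conjI unique_unit hopf_module comodule_algebra one_sided_hopf)
next
  assume "left_connection sD mD uD \<Delta>D \<epsilon>D GD sE \<Delta>E \<epsilon>E GE lact f"
  then interpret left_connection sD mD uD \<Delta>D \<epsilon>D GD sE \<Delta>E \<epsilon>E GE lact f .
  show "(\<exists>!e. e \<in> GE 0 \<and> f e = uD) \<and>
       left_hopf_module sD mD uD \<Delta>D \<epsilon>D sE lact (coaction \<Delta>E f) \<and>
       comodule_algebra sD mD uD \<Delta>D \<epsilon>D sE (left_prod lact f) (conn_unit GE f uD) (coaction \<Delta>E f) \<and>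
       one_sided_hopf_algebra sE (left_prod lact f) (conn_unit GE f uD) \<Delta>E \<epsilon>E"
    by (intro conjI unique_unit hopf_module comodule_algebra one_sided_hopf)
qed

end
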